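(* Let $R$ be a commutative ring with $1$ having more than one maximal ideal. Then $GF(R)$ and $GP(R)$ are connected, and $\operatorname{diam}(GF(R))\leq 4$ and $\operatorname{diam}(GP(R))\leq 4$.
   Context: $GF(R)$ and $GP(R)$ are the simple undirected graphs whose vertices are the proper ideals of $R$; two distinct proper ideals have an edge between them in $GF(R)$ (resp. $GP(R)$) if and only if, for one of the two orderings $(I,J)$ of the pair, $I\subset J$ and $J/I$ is a finitely generated (resp. principal) ideal of $R/I$. The diameter $\operatorname{diam}$ of a graph is the supremum of the distances between pairs of vertices. *)

theory Defs
  imports "HOL-Algebra.QuotRing" "Graph_Theory.Graph_Theory"
begin

text \<open>
  A simple undirected graph, possibly infinite, is encoded as a symmetric loop-free digraph whose
  arcs are pairs of vertices.
\<close>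

definition simple_graph :: "'v set \<Rightarrow> ('v \<Rightarrow> 'v \<Rightarrow> bool) \<Rightarrow> ('v, 'v \<times> 'v) pre_digraph" where
  "simple_graph V E =
     \<lparr>verts = V,
      arcs = {(u, v). u \<in> V \<and> v \<in> V \<and> u \<noteq> v \<and> (E u v \<or> E v u)},
      tail = fst, head = snd\<rparr>"

text \<open>
  The weight 1 on every arc makes \<^const>\<open>wf_digraph.\<mu>\<close> the usual graph distance, with value
  \<open>\<infinity>\<close> between vertices not joined by a walk.
\<close>

definition (in wf_digraph) diameter :: ereal where
  "diameter = (SUP (u, v) \<in> verts G \<times> verts G. \<mu> (\<lambda>_. 1) u v)"

definition proper_ideals :: "('a, 'b) ring_scheme \<Rightarrow> 'a set set" where
  "proper_ideals R = {I. ideal I R \<and> I \<noteq> carrier R}"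

definition finitely_generated_ideal :: "'a set \<Rightarrow> ('a, 'b) ring_scheme \<Rightarrow> bool" where
  "finitely_generated_ideal I R \<longleftrightarrow>
     ideal I R \<and> (\<exists>S. finite S \<and> S \<subseteq> carrier R \<and> I = genideal R S)"

text \<open>\<open>J / I\<close> as a subset of \<open>R Quot I\<close>: the cosets of \<open>I\<close> represented by elements of \<open>J\<close>.\<close>

definition quot_ideal :: "('a, 'b) ring_scheme \<Rightarrow> 'a set \<Rightarrow> 'a set \<Rightarrow> 'a set set" where
  "quot_ideal R J I = (\<lambda>x. I +>\<^bsub>R\<^esub> x) ` J"

definition GF :: "('a, 'b) ring_scheme \<Rightarrow> ('a set, 'a set \<times> 'a set) pre_digraph" where
  "GF R = simple_graph (proper_ideals R)
     (\<lambda>I J. I \<subset> J \<and> finitely_generated_ideal (quot_ideal R J I) (R Quot I))"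

definition GP :: "('a, 'b) ring_scheme \<Rightarrow> ('a set, 'a set \<times> 'a set) pre_digraph" where
  "GP R = simple_graph (proper_ideals R)
     (\<lambda>I J. I \<subset> J \<and> principalideal (quot_ideal R J I) (R Quot I))"

lemma wf_digraph_simple_graph: "wf_digraph (simple_graph V E)"
  by unfold_locales (auto simp: simple_graph_def)

lemma sym_digraph_simple_graph: "sym_digraph (simple_graph V E)"
  by (intro sym_digraph.intro wf_digraph_simple_graph sym_digraph_axioms.intro)
    (auto simp: simple_graph_def symmetric_conv)

lemma loopfree_digraph_simple_graph: "loopfree_digraph (simple_graph V E)"
  by (intro loopfree_digraph.intro wf_digraph_simple_graph loopfree_digraph_axioms.intro)
    (auto simp: simple_graph_def)

end

theory Submission
  imports Defs
begin

text \<open>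
  Two observations give short walks between proper ideals.  First, comaximal ideals
  \<open>I\<close> and \<open>J\<close> are at distance at most two: \<open>I / (I \<inter> J)\<close> is isomorphic to \<open>(I + J) / J = R / J\<close>,
  hence cyclic, so that \<open>I \<inter> J\<close> is adjacent to both \<open>I\<close> and \<open>J\<close> (lemma
  \<open>comaximal_two_steps\<close>).  Second, an ideal \<open>I\<close> inside a proper ideal \<open>M\<close> is adjacent, or equal, to
  \<open>I + (x)\<close> for each \<open>x \<in> M\<close>, and this larger ideal may be comaximal to something to which \<open>I\<close> is not
  (lemma \<open>adjoin_step\<close>).

  Let \<open>M \<noteq> N\<close> be maximal ideals and \<open>I\<close>, \<open>J\<close> proper ideals.
  \<^item> If one of \<open>M\<close>, \<open>N\<close> contains neither \<open>I\<close> nor \<open>J\<close>, it is comaximal to both, and \<open>I\<close> and \<open>J\<close>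
    are joined through it by a walk of length \<open>2 + 2\<close>.
  \<^item> If one of them, say \<open>M\<close>, contains exactly one of the two ideals, say \<open>I\<close>, then \<open>m + j = 1\<close> with
    \<open>m \<in> M\<close> and \<open>j \<in> J\<close>, so \<open>I + (m)\<close> is proper and comaximal to \<open>J\<close>: a walk of length \<open>1 + 2\<close>.
  \<^item> Otherwise both \<open>I\<close> and \<open>J\<close> lie in \<open>M \<inter> N\<close>.  Write \<open>m + n = 1\<close> with \<open>m \<in> M\<close> and \<open>n \<in> N\<close>.
    Then \<open>I + (m)\<close> and \<open>J + (n)\<close> are proper and comaximal: a walk of length \<open>1 + 2 + 1\<close>.

  All steps are edges of \<open>GP\<close>, and \<open>GP\<close> is a subgraph of \<open>GF\<close> on the same vertices, so the bound
  holds in both graphs.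
\<close>

section \<open>Walks that may pause\<close>

text \<open>
  The constructions below may produce consecutive ideals that coincide.  Taking powers of the
  reflexive closure of the arcs absorbs these degenerate steps: dropping the pauses from \<open>n\<close> such
  steps leaves a walk of length at most \<open>n\<close>.
\<close>

lemma simple_graph_relpow_imp_awalk:
  assumes "(u, v) \<in> ((arcs (simple_graph V E))\<^sup>=) ^^ n" and "u \<in> V"
  shows "\<exists>p. pre_digraph.awalk (simple_graph V E) u p v \<and> length p \<le> n"
  using assms
proof (induction n arbitrary: u)
  case 0
  interpret wf_digraph "simple_graph V E" by (rule wf_digraph_simple_graph)
  from 0 have "awalk u [] v" by (auto simp: awalk_Nil_iff) (simp add: simple_graph_def)
  then show ?case by force
next
  case (Suc n)
  interpret wf_digraph "simple_graph V E" by (rule wf_digraph_simple_graph)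
  from Suc.prems obtain w where w: "(u, w) \<in> (arcs (simple_graph V E))\<^sup>="
      "(w, v) \<in> ((arcs (simple_graph V E))\<^sup>=) ^^ n"
    by (blast elim: relpow_Suc_E2)
  with Suc.prems have "w \<in> V" by (auto simp: simple_graph_def)
  from Suc.IH[OF w(2) this] obtain p where p: "awalk w p v" "length p \<le> n" by blast
  show ?case
  proof (cases "u = w")
    case True
    with p show ?thesis using le_SucI by blast
  next
    case False
    with w(1) have "(u, w) \<in> arcs (simple_graph V E)" by simp
    with p(1) have "awalk u ((u, w) # p) v"
      by (intro awalk_ConsI) (auto simp: arc_to_ends_def simple_graph_def)
    with p(2) show ?thesis by (intro exI[of _ "(u, w) # p"]) simp
  qed
qed

lemma simple_graph_connected_diameter_le:
  assumes "V \<noteq> {}"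
    and steps: "\<And>u v. \<lbrakk>u \<in> V; v \<in> V\<rbrakk> \<Longrightarrow> (u, v) \<in> ((arcs (simple_graph V E))\<^sup>=) ^^ n"
  shows "Digraph_Component.connected (simple_graph V E)"
    and "wf_digraph.diameter (simple_graph V E) \<le> ereal (real n)"
proof -
  interpret sym_digraph "simple_graph V E" by (rule sym_digraph_simple_graph)
  have V: "verts (simple_graph V E) = V" by (simp add: simple_graph_def)
  have walk: "\<exists>p. awalk u p v \<and> length p \<le> n" if "u \<in> V" "v \<in> V" for u v
    using simple_graph_relpow_imp_awalk steps that by metis
  have "strongly_connected (simple_graph V E)"
    unfolding strongly_connected_def V using assms(1) walk reachable_awalk by blast
  then show "Digraph_Component.connected (simple_graph V E)"
    unfolding Digraph_Component.connected_def strongly_connected_def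
    using reachable_mk_symmetricI by auto
  have "\<mu> (\<lambda>_. 1) u v \<le> ereal (real n)" if uv: "u \<in> V" "v \<in> V" for u v
  proof -
    from walk[OF uv] obtain p where p: "awalk u p v" "length p \<le> n" by blast
    have "\<mu> (\<lambda>_. 1) u v \<le> ereal (awalk_cost (\<lambda>_. 1) p)"
      by (rule min_cost_le_walk_cost[OF p(1)])
    also have "awalk_cost (\<lambda>_. 1) p = real (length p)"
      by (simp add: awalk_cost_def sum_list_triv)
    also have "ereal (real (length p)) \<le> ereal (real n)" using p(2) by simp
    finally show ?thesis .
  qed
  then show "diameter \<le> ereal (real n)"
    unfolding diameter_def V by (auto intro!: SUP_least)
qed

section \<open>Adjoining one element\<close>

text \<open>
  The cosets of \<open>I\<close> in \<open>I + (x)\<close> are represented by the multiples of \<open>x\<close>.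
\<close>

lemma (in cring) quot_ideal_adjoin_principal:
  assumes "ideal I R" and x: "x \<in> carrier R"
  shows "principalideal (quot_ideal R (I <+> PIdl x) I) (R Quot I)"
proof -
  interpret I: ideal I R by fact
  interpret Q: cring "R Quot I" by (rule I.quotient_is_cring[OF is_cring])
  have carr: "carrier (R Quot I) = (\<lambda>r. I +> r) ` carrier R"
    by (auto simp: FactRing_simps)
  have coset: "I +> (i \<oplus> r \<otimes> x) = (I +> r) \<otimes>\<^bsub>R Quot I\<^esub> (I +> x)"
    if "i \<in> I" "r \<in> carrier R" for i r
  proof -
    have "i \<oplus> r \<otimes> x \<in> I +> (r \<otimes> x)"
      using that by (auto simp: a_r_coset_def')
    then have "I +> (r \<otimes> x) = I +> (i \<oplus> r \<otimes> x)"
      using that x by (intro I.a_repr_independence') auto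
    then show ?thesis
      using that x by (simp add: FactRing_def I.rcoset_mult_add)
  qed
  have "quot_ideal R (I <+> PIdl x) I = PIdl\<^bsub>R Quot I\<^esub> (I +> x)"
  proof
    show "quot_ideal R (I <+> PIdl x) I \<subseteq> PIdl\<^bsub>R Quot I\<^esub> (I +> x)"
      unfolding quot_ideal_def set_add_def' cgenideal_def carr
      using coset by auto
    show "PIdl\<^bsub>R Quot I\<^esub> (I +> x) \<subseteq> quot_ideal R (I <+> PIdl x) I"
    proof
      fix c assume "c \<in> PIdl\<^bsub>R Quot I\<^esub> (I +> x)"
      then obtain r where r: "r \<in> carrier R" "c = (I +> r) \<otimes>\<^bsub>R Quot I\<^esub> (I +> x)"
        by (auto simp: cgenideal_def carr)
      have "c = I +> (\<zero> \<oplus> r \<otimes> x)"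
        using r coset[of \<zero> r] by simp
      moreover have "\<zero> \<oplus> r \<otimes> x \<in> I <+> PIdl x"
        using r(1) I.zero_closed unfolding set_add_def' cgenideal_def by blast
      ultimately show "c \<in> quot_ideal R (I <+> PIdl x) I"
        unfolding quot_ideal_def by blast
    qed
  qed
  then show ?thesis
    using Q.cgenideal_is_principalideal[of "I +> x"] x carr by auto
qed

lemma (in cring) ideal_subset_adjoin:
  assumes "ideal I R" "x \<in> carrier R"
  shows "I \<subseteq> I <+> PIdl x" and "x \<in> I <+> PIdl x"
proof -
  interpret I: ideal I R by fact
  show "I \<subseteq> I <+> PIdl x"
  proof
    fix i assume i: "i \<in> I"
    have "\<zero> \<in> PIdl x"
      using assms(2) by (simp add: additive_subgroup.zero_closed cgenideal_ideal ideal.axioms(1))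
    moreover have "i = i \<oplus> \<zero>" using i by simp
    ultimately show "i \<in> I <+> PIdl x" using i unfolding set_add_def' by blast
  qed
  have "x = \<zero> \<oplus> x" using assms(2) by simp
  then show "x \<in> I <+> PIdl x"
    using cgenideal_self[OF assms(2)] I.zero_closed unfolding set_add_def' by blast
qed

text \<open>Every step of the walks constructed below is of this form, in one of the two directions.\<close>

lemma (in cring) adjoin_is_step:
  assumes I: "ideal I R" and x: "x \<in> carrier R" and proper: "I <+> PIdl x \<noteq> carrier R"
  shows "(I, I <+> PIdl x) \<in> (arcs (GP R))\<^sup>=" and "(I <+> PIdl x, I) \<in> (arcs (GP R))\<^sup>="
proof -
  have J: "ideal (I <+> PIdl x) R" by (rule add_ideals[OF I cgenideal_ideal[OF x]])
  have sub: "I \<subseteq> I <+> PIdl x" by (rule ideal_subset_adjoin[OF I x])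
  have "I \<noteq> carrier R"
    using sub proper additive_subgroup.a_subset[OF ideal.axioms(1)[OF J]] by auto
  with I J sub proper quot_ideal_adjoin_principal[OF I x]
  show "(I, I <+> PIdl x) \<in> (arcs (GP R))\<^sup>=" and "(I <+> PIdl x, I) \<in> (arcs (GP R))\<^sup>="
    unfolding GP_def simple_graph_def proper_ideals_def by auto
qed

text \<open>
  Lying inside \<open>M\<close> is what keeps \<open>I + (x)\<close> proper; it coincides with \<open>I\<close> when \<open>x \<in> I\<close>.
\<close>

lemma (in cring) adjoin_step:
  assumes I: "ideal I R" and M: "ideal M R" "M \<noteq> carrier R" and "I \<subseteq> M" and "x \<in> M"
  obtains K where "K \<in> proper_ideals R" "x \<in> K"
    and "(I, K) \<in> (arcs (GP R))\<^sup>=" "(K, I) \<in> (arcs (GP R))\<^sup>="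
proof -
  interpret M: ideal M R by (rule M)
  have x: "x \<in> carrier R" using \<open>x \<in> M\<close> by simp
  have "I <+> PIdl x \<subseteq> M"
    using \<open>I \<subseteq> M\<close> cgenideal_minimal[OF M(1) \<open>x \<in> M\<close>] unfolding set_add_def' by auto
  then have ne: "I <+> PIdl x \<noteq> carrier R" using M(2) M.a_subset by auto
  then have "I <+> PIdl x \<in> proper_ideals R"
    using add_ideals[OF I cgenideal_ideal[OF x]] by (simp add: proper_ideals_def)
  with that adjoin_is_step[OF I x ne] ideal_subset_adjoin(2)[OF I x] show thesis by blast
qed

section \<open>Comaximal ideals\<close>

text \<open>
  This makes \<open>I / (I \<inter> J)\<close> cyclic: every \<open>z \<in> I\<close> splits as \<open>z = z y + z x\<close> with \<open>z y \<in> I \<inter> J\<close>.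
\<close>

lemma (in cring) comaximal_inter_adjoin:
  assumes "ideal I R" "ideal J R" and xy: "x \<in> I" "y \<in> J" "x \<oplus> y = \<one>"
  shows "I = (I \<inter> J) <+> PIdl x"
proof
  interpret I: ideal I R by fact
  interpret J: ideal J R by fact
  show "I \<subseteq> (I \<inter> J) <+> PIdl x"
  proof
    fix z assume z: "z \<in> I"
    have carr: "x \<in> carrier R" "y \<in> carrier R" "z \<in> carrier R" using xy z by auto
    have "z = z \<otimes> (y \<oplus> x)" using carr xy(3) by (simp add: a_comm)
    also have "\<dots> = z \<otimes> y \<oplus> z \<otimes> x" using carr by (simp add: r_distr)
    finally have "z = z \<otimes> y \<oplus> z \<otimes> x" .
    moreover have "z \<otimes> y \<in> I \<inter> J"
      using carr z xy by (simp add: I.I_r_closed J.I_l_closed)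
    moreover have "z \<otimes> x \<in> PIdl x" using carr unfolding cgenideal_def by blast
    ultimately show "z \<in> (I \<inter> J) <+> PIdl x" unfolding set_add_def' by blast
  qed
  show "(I \<inter> J) <+> PIdl x \<subseteq> I"
    using cgenideal_minimal[OF \<open>ideal I R\<close> \<open>x \<in> I\<close>] unfolding set_add_def' by auto
qed

lemma (in cring) comaximal_two_steps:
  assumes I: "I \<in> proper_ideals R" and J: "J \<in> proper_ideals R"
    and xy: "x \<in> I" "y \<in> J" "x \<oplus> y = \<one>"
  shows "(I, J) \<in> ((arcs (GP R))\<^sup>=) ^^ 2"
proof -
  have id: "ideal I R" "ideal J R" and ne: "I \<noteq> carrier R" "J \<noteq> carrier R"
    using I J by (auto simp: proper_ideals_def)
  have carr: "x \<in> carrier R" "y \<in> carrier R"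
    using xy id by (meson ideal.Icarr)+
  have inter: "ideal (I \<inter> J) R" by (rule i_intersect[OF id])
  have eqI: "I = (I \<inter> J) <+> PIdl x" by (rule comaximal_inter_adjoin[OF id xy])
  have eqJ: "J = (I \<inter> J) <+> PIdl y"
    using comaximal_inter_adjoin[OF id(2) id(1) xy(2) xy(1)] carr xy(3)
    by (simp add: a_comm Int_commute)
  have "(I, I \<inter> J) \<in> (arcs (GP R))\<^sup>="
    using adjoin_is_step(2)[OF inter carr(1)] eqI ne by simp
  moreover have "(I \<inter> J, J) \<in> (arcs (GP R))\<^sup>="
    using adjoin_is_step(1)[OF inter carr(2)] eqJ ne by simp
  ultimately show ?thesis unfolding numeral_2_eq_2 by auto
qed

lemma (in cring) maximalideal_comaximal:
  assumes "maximalideal M R" and J: "ideal J R" and "\<not> J \<subseteq> M"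
  obtains m j where "m \<in> M" "j \<in> J" "m \<oplus> j = \<one>"
proof -
  interpret M: maximalideal M R by fact
  interpret J: ideal J R by fact
  have MJ: "ideal (M <+> J) R" by (rule add_ideals[OF M.is_ideal J])
  have "M \<subseteq> M <+> J"
  proof
    fix m assume "m \<in> M"
    moreover from this have "m = m \<oplus> \<zero>" by simp
    ultimately show "m \<in> M <+> J" using J.zero_closed unfolding set_add_def' by blast
  qed
  moreover have "J \<subseteq> M <+> J"
  proof
    fix j assume "j \<in> J"
    moreover from this have "j = \<zero> \<oplus> j" by simp
    ultimately show "j \<in> M <+> J" using M.zero_closed unfolding set_add_def' by blast
  qed
  ultimately have "M <+> J = carrier R"
    using M.I_maximal[OF MJ] \<open>\<not> J \<subseteq> M\<close>
      additive_subgroup.a_subset[OF ideal.axioms(1)[OF MJ]] by blast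
  then have "\<one> \<in> M <+> J" by simp
  then show thesis using that unfolding set_add_def' by auto
qed

lemma (in cring) maximalideal_two_steps:
  assumes M: "maximalideal M R" and J: "J \<in> proper_ideals R" and "\<not> J \<subseteq> M"
  shows "(M, J) \<in> ((arcs (GP R))\<^sup>=) ^^ 2" and "(J, M) \<in> ((arcs (GP R))\<^sup>=) ^^ 2"
proof -
  interpret M: maximalideal M R by fact
  have "ideal J R" using J by (simp add: proper_ideals_def)
  then obtain m j where mj: "m \<in> M" "j \<in> J" "m \<oplus> j = \<one>"
    using maximalideal_comaximal[OF M _ \<open>\<not> J \<subseteq> M\<close>] by metis
  have carr: "m \<in> carrier R" "j \<in> carrier R"
    using mj \<open>ideal J R\<close> by (auto intro: ideal.Icarr)
  have "M \<in> proper_ideals R"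
    using M.is_ideal M.I_notcarr by (auto simp: proper_ideals_def)
  with J mj carr show "(M, J) \<in> ((arcs (GP R))\<^sup>=) ^^ 2" "(J, M) \<in> ((arcs (GP R))\<^sup>=) ^^ 2"
    by (auto intro: comaximal_two_steps simp: a_comm)
qed

section \<open>Two maximal ideals\<close>

lemma arcs_GP_symmetric: "sym (((arcs (GP R))\<^sup>=) ^^ n)"
proof -
  have "sym ((arcs (GP R))\<^sup>=)" by (auto simp: sym_def GP_def simple_graph_def)
  then have "(v, u) \<in> ((arcs (GP R))\<^sup>=) ^^ n" if "(u, v) \<in> ((arcs (GP R))\<^sup>=) ^^ n" for u v
    using that
    by (induction n arbitrary: v) (auto elim!: relpow_Suc_E intro: relpow_Suc_I2
        dest: symD simp del: relpow.simps(2) Un_iff)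
  then show ?thesis by (rule symI)
qed

text \<open>
  Adjoining to \<open>I\<close> an element \<open>m \<in> M\<close> that is congruent to \<open>1\<close> modulo \<open>J\<close> makes it comaximal to \<open>J\<close>.
\<close>

lemma (in cring) maximalideal_separates_four_steps:
  assumes M: "maximalideal M R" and I: "I \<in> proper_ideals R" and J: "J \<in> proper_ideals R"
    and "I \<subseteq> M" "\<not> J \<subseteq> M"
  shows "(I, J) \<in> ((arcs (GP R))\<^sup>=) ^^ 4"
proof -
  interpret M: maximalideal M R by fact
  have id: "ideal I R" "ideal J R" using I J by (auto simp: proper_ideals_def)
  obtain m j where mj: "m \<in> M" "j \<in> J" "m \<oplus> j = \<one>"
    using maximalideal_comaximal[OF M id(2) \<open>\<not> J \<subseteq> M\<close>] by metis
  obtain K where K: "K \<in> proper_ideals R" "m \<in> K" "(I, K) \<in> (arcs (GP R))\<^sup>="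
    using adjoin_step[OF id(1) M.is_ideal M.I_notcarr[symmetric] \<open>I \<subseteq> M\<close> mj(1)] by metis
  have "(K, J) \<in> ((arcs (GP R))\<^sup>=) ^^ 2"
    by (rule comaximal_two_steps[OF K(1) J K(2) mj(2,3)])
  with K(3) have "(I, J) \<in> ((arcs (GP R))\<^sup>=) ^^ Suc 2" by (rule relpow_Suc_I2)
  \<comment> \<open>three steps suffice; the fourth is a pause at \<open>J\<close>\<close>
  then have "(I, J) \<in> ((arcs (GP R))\<^sup>=) ^^ Suc (Suc 2)" by (rule relpow_Suc_I) simp
  then show ?thesis by (simp add: numeral_eq_Suc)
qed

lemma (in cring) GP_four_steps:
  assumes M: "maximalideal M R" and N: "maximalideal N R" and "M \<noteq> N"
    and I: "I \<in> proper_ideals R" and J: "J \<in> proper_ideals R"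
  shows "(I, J) \<in> ((arcs (GP R))\<^sup>=) ^^ 4"
proof -
  interpret M: maximalideal M R by fact
  interpret N: maximalideal N R by fact
  have sym: "(J, I) \<in> ((arcs (GP R))\<^sup>=) ^^ 4 \<Longrightarrow> ?thesis"
    using arcs_GP_symmetric by (metis symD)
  \<comment> \<open>a maximal ideal that contains neither \<open>I\<close> nor \<open>J\<close> is comaximal to both\<close>
  have outside: ?thesis if "maximalideal L R" "\<not> I \<subseteq> L" "\<not> J \<subseteq> L" for L
  proof -
    have "(I, L) \<in> ((arcs (GP R))\<^sup>=) ^^ 2" "(L, J) \<in> ((arcs (GP R))\<^sup>=) ^^ 2"
      using maximalideal_two_steps that I J by auto
    then have "(I, J) \<in> ((arcs (GP R))\<^sup>=) ^^ (2 + 2)"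
      unfolding relpow_add by (rule relcompI)
    then show ?thesis by simp
  qed
  \<comment> \<open>comaximality of \<open>M\<close> and \<open>N\<close> is passed on to the enlarged ideals\<close>
  have inside: ?thesis if "I \<subseteq> M" "J \<subseteq> N"
  proof -
    have id: "ideal I R" "ideal J R" using I J by (auto simp: proper_ideals_def)
    have "\<not> N \<subseteq> M"
      using N.I_maximal[OF M.is_ideal] \<open>M \<noteq> N\<close> M.I_notcarr M.a_subset by auto
    then obtain m n where mn: "m \<in> M" "n \<in> N" "m \<oplus> n = \<one>"
      using maximalideal_comaximal[OF M N.is_ideal] by metis
    obtain K where K: "K \<in> proper_ideals R" "m \<in> K" "(I, K) \<in> (arcs (GP R))\<^sup>="
      using adjoin_step[OF id(1) M.is_ideal M.I_notcarr[symmetric] \<open>I \<subseteq> M\<close> mn(1)] by metis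
    obtain L where L: "L \<in> proper_ideals R" "n \<in> L" "(L, J) \<in> (arcs (GP R))\<^sup>="
      using adjoin_step[OF id(2) N.is_ideal N.I_notcarr[symmetric] \<open>J \<subseteq> N\<close> mn(2)] by metis
    have "(K, L) \<in> ((arcs (GP R))\<^sup>=) ^^ 2"
      by (rule comaximal_two_steps[OF K(1) L(1) K(2) L(2) mn(3)])
    with K(3) have "(I, L) \<in> ((arcs (GP R))\<^sup>=) ^^ Suc 2" by (rule relpow_Suc_I2)
    then have "(I, J) \<in> ((arcs (GP R))\<^sup>=) ^^ Suc (Suc 2)" using L(3) by (rule relpow_Suc_I)
    then show ?thesis by (simp add: numeral_eq_Suc)
  qed
  show ?thesis
    using outside[OF M] outside[OF N] inside sym
      maximalideal_separates_four_steps[OF M I J] maximalideal_separates_four_steps[OF M J I]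
      maximalideal_separates_four_steps[OF N I J] maximalideal_separates_four_steps[OF N J I]
    by blast
qed

lemma arcs_GP_subset_GF: "arcs (GP R) \<subseteq> arcs (GF R)"
proof -
  have "finitely_generated_ideal K Q" if "principalideal K Q" for K and Q :: "('c, 'd) ring_scheme"
    using that unfolding finitely_generated_ideal_def principalideal_def principalideal_axioms_def
    by (metis empty_subsetI finite.emptyI finite.insertI insert_subset)
  then show ?thesis unfolding GP_def GF_def simple_graph_def by auto
qed

theorem theorem6p6:
  fixes R :: "('a, 'b) ring_scheme"
  assumes "cring R"
    and "\<exists>M N. maximalideal M R \<and> maximalideal N R \<and> M \<noteq> N"
  shows "Digraph_Component.connected (GF R) \<and> Digraph_Component.connected (GP R)
    \<and> wf_digraph.diameter (GF R) \<le> 4 \<and> wf_digraph.diameter (GP R) \<le> 4"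
proof -
  interpret cring R by fact
  obtain M N where MN: "maximalideal M R" "maximalideal N R" "M \<noteq> N" using assms(2) by blast
  have ne: "proper_ideals R \<noteq> {}"
    using MN(1) unfolding proper_ideals_def
    by (metis (mono_tags, lifting) empty_iff maximalideal.I_notcarr maximalideal.axioms(1)
        mem_Collect_eq)
  have GP: "(I, J) \<in> ((arcs (GP R))\<^sup>=) ^^ 4"
    if "I \<in> proper_ideals R" "J \<in> proper_ideals R" for I J
    using GP_four_steps[OF MN that] .
  have "(arcs (GP R))\<^sup>= \<subseteq> (arcs (GF R))\<^sup>=" using arcs_GP_subset_GF by blast
  then have mono: "((arcs (GP R))\<^sup>=) ^^ n \<subseteq> ((arcs (GF R))\<^sup>=) ^^ n" for n
    by (induction n) (simp_all only: relpow.simps relcomp_mono subset_refl)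
  then have GF: "(I, J) \<in> ((arcs (GF R))\<^sup>=) ^^ 4"
    if "I \<in> proper_ideals R" "J \<in> proper_ideals R" for I J
    using GP[OF that] mono by blast
  show ?thesis
    using simple_graph_connected_diameter_le[OF ne GP[unfolded GP_def]]
      simple_graph_connected_diameter_le[OF ne GF[unfolded GF_def]]
    by (simp add: GP_def GF_def)
qed

end
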